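(* Consider the scalar $N$-player linear quadratic dynamic game with dynamics $x(k+1)=ax(k)+\sum_{i=1}^N b_iu_i(k)$, $x(0)=x_0$, and cost functionals $J_i(x_0,u_1,\dots,u_N)=\sum_{k=0}^\infty\left(q_ix(k)^2+r_iu_i(k)^2\right)$, $i=1,\dots,N$, where $N\in\mathbb{N}$, $a\in\mathbb{R}$, $b_i\in\mathbb{R}\setminus\{0\}$, $q_i\in\mathbb{R}$, $r_i\in\mathbb{R}_{>0}$. Let $\sigma_i:=\frac{b_i^2q_i}{r_i}$, $i=1,\dots,N$, and assume that the players are ordered such that $\sigma_1\ge\sigma_2\ge\dots\ge\sigma_N$ and that $\sigma_N>-1$. Consider the function $$\hat f(\xi)=\begin{cases}-\xi-\sqrt{\xi^2+1}&\text{if }\xi<0,\\-\xi+\sqrt{\xi^2+1}&\text{if }\xi>0.\end{cases}$$ The set of strategies $\{u_1^\star,\dots,u_N^\star\}$, where $u_i^\star(k)=k_ix(k)$ with $$k_i=\frac{-\xi-t_i\sqrt{\xi^2-\sigma_i}}{b_i},\qquad i=1,\dots,N,$$ constitutes a feedback Nash equilibrium (FNE) of the game with $a_{cl}\neq0$, where $a_{cl}:=a+\sum_{j=1}^Nb_jk_j$, if and only if there exist $t_i\in\{-1,1\}$, for $i=1,\dots,N$, and $\xi\in\mathbb{R}\setminus\{0\}$, satisfying $$a=\hat f(\xi)+N\xi+t_1\sqrt{\xi^2-\sigma_1}+\dots+t_N\sqrt{\xi^2-\sigma_N}.$$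
   Context: The state $x\in\mathbb{R}$ and the inputs $u_i\in\mathbb{R}$ are scalar; the cost functional $J_i$ is associated with player $i$, who chooses $u_i$. A set of feedback strategies $\{u_1,\dots,u_N\}$ with $u_i=k_ix$, $i=1,\dots,N$, is admissible if it renders the zero equilibrium of the system asymptotically stable (that is, $|a_{cl}|<1$). An admissible set of strategies $\{u_1^\star,\dots,u_N^\star\}$ constitutes a Nash equilibrium of the game if $J_i(x_0,u_i^\star,u_{-i}^\star)\le J_i(x_0,u_i,u_{-i}^\star)$ holds for all admissible $\{u_i,u_{-i}^\star\}$, for $i=1,\dots,N$, where $u_{-i}=\{u_1,\dots,u_{i-1},u_{i+1},\dots,u_N\}$. A feedback Nash equilibrium (FNE) is a Nash equilibrium involving linear static state-feedback strategies $u_i^\star(k)=k_ix(k)$. *)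

theory Defs
  imports Complex_Main
begin

text \<open>Players are indexed by \<open>{1..N}\<close>; a profile \<open>u\<close> assigns to player \<open>i\<close> the static state
  feedback \<open>u i :: real \<Rightarrow> real\<close>. Values at indices outside \<open>{1..N}\<close> play no role.\<close>

definition next_state ::
    "nat \<Rightarrow> real \<Rightarrow> (nat \<Rightarrow> real) \<Rightarrow> (nat \<Rightarrow> real \<Rightarrow> real) \<Rightarrow> real \<Rightarrow> real" where
  "next_state N a b u x = a * x + (\<Sum>i\<in>{1..N}. b i * u i x)"

definition state ::
    "nat \<Rightarrow> real \<Rightarrow> (nat \<Rightarrow> real) \<Rightarrow> (nat \<Rightarrow> real \<Rightarrow> real) \<Rightarrow> real \<Rightarrow> nat \<Rightarrow> real" where
  "state N a b u x0 n = (next_state N a b u ^^ n) x0"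

text \<open>By \<open>summable_cost\<close> below, the series converges for every admissible profile, so the value
  that \<open>suminf\<close> takes on divergent series never enters the equilibrium condition.\<close>

definition cost ::
    "nat \<Rightarrow> real \<Rightarrow> (nat \<Rightarrow> real) \<Rightarrow> (nat \<Rightarrow> real) \<Rightarrow> (nat \<Rightarrow> real) \<Rightarrow> nat \<Rightarrow> real
      \<Rightarrow> (nat \<Rightarrow> real \<Rightarrow> real) \<Rightarrow> real" where
  "cost N a b q r i x0 u =
     (\<Sum>n. q i * (state N a b u x0 n)\<^sup>2 + r i * (u i (state N a b u x0 n))\<^sup>2)"

definition linear_feedback :: "(nat \<Rightarrow> real) \<Rightarrow> nat \<Rightarrow> real \<Rightarrow> real" where
  "linear_feedback k i x = k i * x"

definition closed_loop :: "nat \<Rightarrow> real \<Rightarrow> (nat \<Rightarrow> real) \<Rightarrow> (nat \<Rightarrow> real) \<Rightarrow> real" where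
  "closed_loop N a b k = a + (\<Sum>j\<in>{1..N}. b j * k j)"

definition asymptotically_stable_zero :: "(real \<Rightarrow> real) \<Rightarrow> bool" where
  "asymptotically_stable_zero f \<longleftrightarrow>
     (\<forall>\<epsilon>>0. \<exists>\<delta>>0. \<forall>x. \<bar>x\<bar> < \<delta> \<longrightarrow> (\<forall>n. \<bar>(f ^^ n) x\<bar> < \<epsilon>)) \<and>
     (\<exists>\<delta>>0. \<forall>x. \<bar>x\<bar> < \<delta> \<longrightarrow> (\<lambda>n. (f ^^ n) x) \<longlonglongrightarrow> 0)"

definition admissible ::
    "nat \<Rightarrow> real \<Rightarrow> (nat \<Rightarrow> real) \<Rightarrow> (nat \<Rightarrow> real \<Rightarrow> real) \<Rightarrow> bool" where
  "admissible N a b u \<longleftrightarrow>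
     (\<exists>k. \<forall>i\<in>{1..N}. u i = linear_feedback k i) \<and> asymptotically_stable_zero (next_state N a b u)"

text \<open>A unilateral deviation of player \<open>i\<close> to \<open>v\<close> is \<open>u(i := v)\<close>; admissibility forces \<open>v\<close> to be
  linear, and it forces an equilibrium to consist of linear state feedbacks. The inequality is
  required for every initial state, as the strategies do not depend on it.\<close>

definition feedback_nash_equilibrium ::
    "nat \<Rightarrow> real \<Rightarrow> (nat \<Rightarrow> real) \<Rightarrow> (nat \<Rightarrow> real) \<Rightarrow> (nat \<Rightarrow> real)
      \<Rightarrow> (nat \<Rightarrow> real \<Rightarrow> real) \<Rightarrow> bool" where
  "feedback_nash_equilibrium N a b q r u \<longleftrightarrow>
     admissible N a b u \<and>
     (\<forall>i\<in>{1..N}. \<forall>v. admissible N a b (u(i := v)) \<longrightarrow>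
        (\<forall>x0. cost N a b q r i x0 u \<le> cost N a b q r i x0 (u(i := v))))"

definition sigma :: "(nat \<Rightarrow> real) \<Rightarrow> (nat \<Rightarrow> real) \<Rightarrow> (nat \<Rightarrow> real) \<Rightarrow> nat \<Rightarrow> real" where
  "sigma b q r i = (b i)\<^sup>2 * q i / r i"

text \<open>Only used at nonzero arguments; the value at \<open>0\<close> is an artefact.\<close>

definition f_hat :: "real \<Rightarrow> real" where
  "f_hat \<xi> = (if \<xi> < 0 then - \<xi> - sqrt (\<xi>\<^sup>2 + 1) else - \<xi> + sqrt (\<xi>\<^sup>2 + 1))"


lemma next_state_linear:
  assumes "\<And>i. i \<in> {1..N} \<Longrightarrow> u i = linear_feedback k i"
  shows "next_state N a b u = (\<lambda>x. closed_loop N a b k * x)"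
proof
  fix x
  have "(\<Sum>i\<in>{1..N}. b i * u i x) = (\<Sum>i\<in>{1..N}. b i * k i) * x"
    using assms by (simp add: sum_distrib_right linear_feedback_def mult.assoc)
  then show "next_state N a b u x = closed_loop N a b k * x"
    by (simp add: next_state_def closed_loop_def distrib_right)
qed

lemma funpow_scale: "((\<lambda>x. c * x) ^^ n) x = c ^ n * (x :: real)"
  by (induction n) (simp_all add: mult.assoc)

lemma asymptotically_stable_zero_linear:
  "asymptotically_stable_zero (\<lambda>x. c * x) \<longleftrightarrow> \<bar>c\<bar> < 1"
proof
  assume "asymptotically_stable_zero (\<lambda>x. c * x)"
  then obtain d where d: "d > 0" "\<And>x. \<bar>x\<bar> < d \<Longrightarrow> (\<lambda>n. c ^ n * x) \<longlonglongrightarrow> 0"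
    unfolding asymptotically_stable_zero_def funpow_scale by blast
  from d(1) have "(\<lambda>n. c ^ n * (d / 2)) \<longlonglongrightarrow> 0"
    by (intro d(2)) simp
  from tendsto_mult_right_zero[OF this, of "2 / d"] d(1) have "(\<lambda>n. c ^ n) \<longlonglongrightarrow> 0"
    by (simp add: field_simps)
  then obtain n where "\<bar>c ^ n\<bar> < 1"
    by (metis LIMSEQ_D diff_zero order_refl real_norm_def zero_less_one)
  then show "\<bar>c\<bar> < 1"
    by (metis not_less one_le_power power_abs)
next
  assume c: "\<bar>c\<bar> < 1"
  have le: "\<bar>c ^ n * x\<bar> \<le> \<bar>x\<bar>" for n x
    using c by (simp add: abs_mult power_abs mult_left_le_one_le power_le_one)
  have "(\<lambda>n. c ^ n * x) \<longlonglongrightarrow> 0" for x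
    using c by (intro tendsto_mult_left_zero LIMSEQ_power_zero) simp
  then show "asymptotically_stable_zero (\<lambda>x. c * x)"
    unfolding asymptotically_stable_zero_def funpow_scale
    using le by (meson le_less_trans zero_less_one)
qed

lemma admissible_linear_feedback:
  "admissible N a b (linear_feedback k) \<longleftrightarrow> \<bar>closed_loop N a b k\<bar> < 1"
  unfolding admissible_def using next_state_linear[of N "linear_feedback k" k a b]
  by (auto simp: asymptotically_stable_zero_linear)

lemma summable_cost:
  assumes "admissible N a b u" and i: "i \<in> {1..N}"
  shows "summable (\<lambda>n. q i * (state N a b u x0 n)\<^sup>2 + r i * (u i (state N a b u x0 n))\<^sup>2)"
proof -
  from assms(1) obtain k where k: "\<And>i. i \<in> {1..N} \<Longrightarrow> u i = linear_feedback k i"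
    unfolding admissible_def by blast
  define c where "c = closed_loop N a b k"
  have ns: "next_state N a b u = (\<lambda>x. c * x)"
    unfolding c_def by (rule next_state_linear) (rule k)
  with assms(1) have "\<bar>c\<bar> < 1"
    by (simp add: admissible_def asymptotically_stable_zero_linear)
  then have "summable (\<lambda>n. (c\<^sup>2) ^ n)"
    by (intro summable_geometric) (simp add: abs_square_less_1)
  then have "summable (\<lambda>n. (q i + r i * (k i)\<^sup>2) * x0\<^sup>2 * (c\<^sup>2) ^ n)"
    by (rule summable_mult)
  moreover have st: "state N a b u x0 n = c ^ n * x0" for n
    by (simp add: state_def ns funpow_scale)
  have "(q i + r i * (k i)\<^sup>2) * x0\<^sup>2 * (c\<^sup>2) ^ n
      = q i * (state N a b u x0 n)\<^sup>2 + r i * (u i (state N a b u x0 n))\<^sup>2" for n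
    by (simp add: st k[OF i] linear_feedback_def power_mult_distrib power_mult[symmetric]
        algebra_simps)
  ultimately show ?thesis by simp
qed

end

theory Submission
  imports Defs
begin

text \<open>Let \<open>c\<close> be the closed loop gain and \<open>y = b\<^sub>i k\<^sub>i\<close>. Up to a positive factor, the cost
  of player \<open>i\<close> after a deviation that moves the closed loop gain to \<open>s\<close> is
  \<open>(\<sigma>\<^sub>i + (s - c + y)\<^sup>2) / (1 - s\<^sup>2)\<close>. After clearing denominators, optimality of \<open>s = c\<close> on
  \<open>(-1, 1)\<close> says that a quadratic polynomial in \<open>s - c\<close> without constant term is nonnegative near
  \<open>0\<close>, so its linear coefficient vanishes: \<open>c y\<^sup>2 + (1 - c\<^sup>2) y + c \<sigma>\<^sub>i = 0\<close>. The leading coefficient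
  is then automatically nonnegative because \<open>\<sigma>\<^sub>i > -1\<close>. With \<open>\<xi> = (1 - c\<^sup>2) / (2 c)\<close> the
  equation reads \<open>(y + \<xi>)\<^sup>2 = \<xi>\<^sup>2 - \<sigma>\<^sub>i\<close>, and \<open>c\<close> is recovered from \<open>\<xi>\<close> as \<open>f_hat \<xi>\<close>.\<close>

section \<open>Costs and deviations of linear feedback profiles\<close>

lemma closed_loop_fun_upd:
  assumes "i \<in> {1..N}"
  shows "closed_loop N a b (k(i := l)) = closed_loop N a b k + b i * (l - k i)"
proof -
  have "(\<Sum>j\<in>{1..N} - {i}. b j * (k(i := l)) j) = (\<Sum>j\<in>{1..N} - {i}. b j * k j)"
    by (rule sum.cong) auto
  then show ?thesis
    using assms by (simp add: closed_loop_def sum.remove[of _ i] algebra_simps)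
qed

lemma linear_feedback_fun_upd:
  "(linear_feedback k)(i := linear_feedback m i) = linear_feedback (k(i := m i))"
  by (auto simp: fun_eq_iff linear_feedback_def)

lemma cost_linear_feedback:
  assumes "\<bar>closed_loop N a b k\<bar> < 1"
  shows "cost N a b q r i x0 (linear_feedback k)
    = (q i + r i * (k i)\<^sup>2) / (1 - (closed_loop N a b k)\<^sup>2) * x0\<^sup>2"
proof -
  define c where "c = closed_loop N a b k"
  have "state N a b (linear_feedback k) x0 n = c ^ n * x0" for n
    using next_state_linear[of N "linear_feedback k" k a b]
    by (simp add: state_def funpow_scale c_def)
  then have "cost N a b q r i x0 (linear_feedback k)
      = (\<Sum>n. ((q i + r i * (k i)\<^sup>2) * x0\<^sup>2) * (c\<^sup>2) ^ n)"
    unfolding cost_def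
    by (intro suminf_cong) (simp add: linear_feedback_def power_mult_distrib
        power_mult[symmetric] algebra_simps)
  also have "\<dots> = (q i + r i * (k i)\<^sup>2) * x0\<^sup>2 * (1 / (1 - c\<^sup>2))"
    using assms by (simp add: c_def abs_square_less_1 suminf_mult suminf_geometric
        summable_geometric)
  finally show ?thesis by (simp add: c_def)
qed

text \<open>Admissibility forces a deviation to be linear, so only the new gain \<open>l\<close>
  matters. Both costs are multiples of \<open>x0\<^sup>2\<close>, so the comparison no longer
  involves the initial state.\<close>

lemma feedback_nash_equilibrium_linear_feedback_iff:
  "feedback_nash_equilibrium N a b q r (linear_feedback k) \<longleftrightarrow>
    \<bar>closed_loop N a b k\<bar> < 1 \<and>
    (\<forall>i\<in>{1..N}. \<forall>l. \<bar>closed_loop N a b k + b i * (l - k i)\<bar> < 1 \<longrightarrow>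
      (q i + r i * (k i)\<^sup>2) / (1 - (closed_loop N a b k)\<^sup>2)
        \<le> (q i + r i * l\<^sup>2) / (1 - (closed_loop N a b k + b i * (l - k i))\<^sup>2))"
    (is "?L \<longleftrightarrow> ?S \<and> (\<forall>i\<in>_. ?R i)")
proof -
  have "(\<forall>v. admissible N a b ((linear_feedback k)(i := v)) \<longrightarrow>
      (\<forall>x0. cost N a b q r i x0 (linear_feedback k)
        \<le> cost N a b q r i x0 ((linear_feedback k)(i := v)))) \<longleftrightarrow> ?R i" (is "?D \<longleftrightarrow> _")
    if i: "i \<in> {1..N}" and c: ?S for i
  proof -
    have "?D \<longleftrightarrow> (\<forall>l. admissible N a b (linear_feedback (k(i := l))) \<longrightarrow>
      (\<forall>x0. cost N a b q r i x0 (linear_feedback k)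
        \<le> cost N a b q r i x0 (linear_feedback (k(i := l)))))" (is "_ \<longleftrightarrow> ?E")
    proof
      assume D: ?D
      show ?E
        using D linear_feedback_fun_upd[of k i "\<lambda>_. l" for l] by metis
    next
      assume E: ?E
      show ?D
      proof (intro allI impI)
        fix v x0
        assume v: "admissible N a b ((linear_feedback k)(i := v))"
        then obtain m where "v = linear_feedback m i"
          using i unfolding admissible_def by (metis fun_upd_same)
        with v E show "cost N a b q r i x0 (linear_feedback k)
            \<le> cost N a b q r i x0 ((linear_feedback k)(i := v))"
          by (simp add: linear_feedback_fun_upd)
      qed
    qed
    also have "\<dots> \<longleftrightarrow> ?R i"
    proof -
      \<comment> \<open>The choice \<open>x0 = 1\<close> gives the forward direction.\<close>
      have "(\<forall>x0::real. A * x0\<^sup>2 \<le> B * x0\<^sup>2) \<longleftrightarrow> A \<le> B" for A B :: real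
        using mult_right_mono[of A B] by (metis mult.right_neutral one_power2 zero_le_power2)
      then show ?thesis
        using c i by (simp add: admissible_linear_feedback closed_loop_fun_upd
            cost_linear_feedback del: times_divide_eq_left cong: imp_cong)
    qed
    finally show ?thesis .
  qed
  then show ?thesis
    unfolding feedback_nash_equilibrium_def admissible_linear_feedback by blast
qed

section \<open>Optimality of one player's gain against the others\<close>

lemma linear_coeff_zero_if_nonneg_near_zero:
  fixes A B e :: real
  assumes "e > 0" and "\<And>d. \<bar>d\<bar> < e \<Longrightarrow> 0 \<le> A * d\<^sup>2 + B * d"
  shows "B = 0"
proof (rule DERIV_local_min[where f = "\<lambda>d. A * d\<^sup>2 + B * d" and x = 0])
  show "((\<lambda>d. A * d\<^sup>2 + B * d) has_real_derivative B) (at 0)"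
    by (auto intro!: derivative_eq_intros)
qed (use assms in auto)

lemma best_response_iff:
  fixes b c k q r :: real
  assumes b: "b \<noteq> 0" and r: "r > 0" and c: "\<bar>c\<bar> < 1" "c \<noteq> 0" and \<sigma>: "b\<^sup>2 * q / r > -1"
  shows "(\<forall>l. \<bar>c + b * (l - k)\<bar> < 1 \<longrightarrow>
      (q + r * k\<^sup>2) / (1 - c\<^sup>2) \<le> (q + r * l\<^sup>2) / (1 - (c + b * (l - k))\<^sup>2))
    \<longleftrightarrow> c * (b * k)\<^sup>2 + (1 - c\<^sup>2) * (b * k) + c * (b\<^sup>2 * q / r) = 0"
    (is "?L \<longleftrightarrow> ?R")
proof -
  define s y where "s = b\<^sup>2 * q / r" and "y = b * k"
  \<comment> \<open>These are the coefficients of \<open>d\<^sup>2\<close> and \<open>d\<close> in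
    the cost difference, for a shift \<open>d\<close> of the closed loop gain, after clearing the
    positive denominators and the factor \<open>r / b\<^sup>2\<close>.\<close>
  define A B where "A = 1 - c\<^sup>2 + s + y\<^sup>2" and "B = 2 * (c * y\<^sup>2 + (1 - c\<^sup>2) * y + c * s)"
  have c1: "c\<^sup>2 < 1"
    using c by (simp add: abs_square_less_1)
  have q: "q = r * s / b\<^sup>2"
    using b r by (simp add: s_def)
  have dev: "(q + r * k\<^sup>2) / (1 - c\<^sup>2) \<le> (q + r * l\<^sup>2) / (1 - (c + b * (l - k))\<^sup>2)
      \<longleftrightarrow> 0 \<le> A * (b * (l - k))\<^sup>2 + B * (b * (l - k))" if l: "\<bar>c + b * (l - k)\<bar> < 1" for l
  proof -
    define d where "d = b * (l - k)"
    have d1: "(c + d)\<^sup>2 < 1"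
      using l by (simp add: abs_square_less_1 d_def)
    have *: "q + r * k\<^sup>2 = r / b\<^sup>2 * (s + y\<^sup>2)" "q + r * l\<^sup>2 = r / b\<^sup>2 * (s + (y + d)\<^sup>2)"
      using b by (simp_all add: q y_def d_def field_simps power2_eq_square)
    have "(q + r * k\<^sup>2) / (1 - c\<^sup>2) \<le> (q + r * l\<^sup>2) / (1 - (c + d)\<^sup>2)
        \<longleftrightarrow> r / b\<^sup>2 * ((s + y\<^sup>2) / (1 - c\<^sup>2)) \<le> r / b\<^sup>2 * ((s + (y + d)\<^sup>2) / (1 - (c + d)\<^sup>2))"
      unfolding * by simp
    also have "\<dots> \<longleftrightarrow> (s + y\<^sup>2) / (1 - c\<^sup>2) \<le> (s + (y + d)\<^sup>2) / (1 - (c + d)\<^sup>2)"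
      using b r by (intro mult_le_cancel_left_pos) simp
    also have "\<dots> \<longleftrightarrow> (s + y\<^sup>2) * (1 - (c + d)\<^sup>2) \<le> (s + (y + d)\<^sup>2) * (1 - c\<^sup>2)"
      using c1 d1 by (simp add: divide_simps)
    also have "\<dots> \<longleftrightarrow> 0 \<le> A * d\<^sup>2 + B * d"
    proof -
      have "(s + (y + d)\<^sup>2) * (1 - c\<^sup>2) - (s + y\<^sup>2) * (1 - (c + d)\<^sup>2) = A * d\<^sup>2 + B * d"
        unfolding A_def B_def by algebra
      then show ?thesis by linarith
    qed
    finally show ?thesis by (simp add: d_def)
  qed
  have "?L \<longleftrightarrow> B = 0"
  proof
    assume L: ?L
    show "B = 0"
    proof (rule linear_coeff_zero_if_nonneg_near_zero[of "1 - \<bar>c\<bar>"])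
      fix d assume "\<bar>d\<bar> < 1 - \<bar>c\<bar>"
      \<comment> \<open>The gain \<open>k + d / b\<close> moves the closed loop gain from
        \<open>c\<close> to \<open>c + d\<close>, which stays in the stable interval by the triangle
        inequality.\<close>
      then have "\<bar>c + b * ((k + d / b) - k)\<bar> < 1"
        using b by simp
      with L dev[of "k + d / b"]
      have "0 \<le> A * (b * ((k + d / b) - k))\<^sup>2 + B * (b * ((k + d / b) - k))"
        by blast
      then show "0 \<le> A * d\<^sup>2 + B * d"
        using b by simp
    qed (use c in simp)
  next
    assume B: "B = 0"
    have "0 \<le> A"
    proof (rule ccontr)
      assume "\<not> 0 \<le> A"
      \<comment> \<open>Eliminating \<open>s\<close> through \<open>B = 0\<close> leaves
        \<open>c * A = (1 - c\<^sup>2) * (c - y)\<close>. One more factor \<open>c\<close> makes the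
        sign of \<open>A\<close> that of \<open>c * (c - y)\<close> without a case split on the sign
        of \<open>c\<close>.\<close>
      moreover have cA: "c\<^sup>2 * A = (1 - c\<^sup>2) * (c * (c - y))"
        using B unfolding A_def B_def by algebra
      ultimately have neg: "c * (c - y) < 0"
        using c c1 by (smt (verit) mult_nonneg_nonneg mult_pos_neg zero_less_power2)
      \<comment> \<open>\<open>c\<close> and \<open>-1/c\<close> are the roots of \<open>c z\<^sup>2 + (1 - c\<^sup>2) z - c\<close>, which at \<open>z = y\<close> equals \<open>-c (1 + s)\<close>.\<close>
      have "(c * (c - y)) * (c * y + 1) = c\<^sup>2 * (1 + s)"
        using B unfolding B_def by algebra
      moreover have "c\<^sup>2 * (1 + s) > 0"
        using \<sigma> c by (simp add: s_def)
      ultimately have "c * y + 1 < 0"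
        using neg by (metis mult_less_0_iff not_less_iff_gr_or_eq zero_less_mult_iff)
      moreover have "c * y > c\<^sup>2"
        using neg by (simp add: algebra_simps power2_eq_square)
      ultimately show False
        using zero_le_power2[of c] by linarith
    qed
    then show ?L
      using dev B by simp
  qed
  also have "\<dots> \<longleftrightarrow> c * y\<^sup>2 + (1 - c\<^sup>2) * y + c * s = 0"
    unfolding B_def by (metis mult_eq_0_iff zero_neq_numeral)
  finally show ?thesis
    by (simp only: s_def y_def)
qed

section \<open>The correspondence between \<xi> and the closed loop gain\<close>

lemma f_hat_root: "(f_hat \<xi>)\<^sup>2 + 2 * \<xi> * f_hat \<xi> = 1"
proof -
  have "(sqrt (\<xi>\<^sup>2 + 1))\<^sup>2 = \<xi>\<^sup>2 + 1"
    by simp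
  then show ?thesis
    unfolding f_hat_def by (auto simp: power2_eq_square algebra_simps)
qed

text \<open>The roots of \<open>z\<^sup>2 + 2 * \<xi> * z - 1\<close> have product -1, hence
  opposite signs; the sign of \<xi> tells \<open>f_hat \<xi>\<close> apart from the other
  root.\<close>

lemma f_hat_sgn: "\<xi> \<noteq> 0 \<Longrightarrow> \<xi> * f_hat \<xi> > 0"
proof -
  assume "\<xi> \<noteq> 0"
  moreover have "\<bar>\<xi>\<bar> < sqrt (\<xi>\<^sup>2 + 1)"
    by (rule real_less_rsqrt) simp
  ultimately show ?thesis
    by (auto simp: f_hat_def zero_less_mult_iff)
qed

text \<open>A root \<open>c\<close> with \<open>\<xi> * c > 0\<close> satisfies
  \<open>c\<^sup>2 = 1 - 2 * \<xi> * c < 1\<close>, so \<open>f_hat\<close> selects the stable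
  root.\<close>

lemma f_hat_eq_iff:
  assumes "\<xi> \<noteq> 0"
  shows "c = f_hat \<xi> \<longleftrightarrow> c \<noteq> 0 \<and> \<bar>c\<bar> < 1 \<and> \<xi> = (1 - c\<^sup>2) / (2 * c)"
proof
  assume c: "c = f_hat \<xi>"
  have root: "c\<^sup>2 + 2 * (\<xi> * c) = 1" and pos: "\<xi> * c > 0"
    using f_hat_root[of \<xi>] f_hat_sgn[OF assms] by (simp_all add: c)
  then have "c\<^sup>2 < 1" by linarith
  moreover have "c \<noteq> 0" using pos by auto
  ultimately show "c \<noteq> 0 \<and> \<bar>c\<bar> < 1 \<and> \<xi> = (1 - c\<^sup>2) / (2 * c)"
    using root by (simp add: abs_square_less_1 field_simps)
next
  assume c: "c \<noteq> 0 \<and> \<bar>c\<bar> < 1 \<and> \<xi> = (1 - c\<^sup>2) / (2 * c)"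
  then have root: "c\<^sup>2 + 2 * (\<xi> * c) = 1" and "c\<^sup>2 < 1"
    by (simp_all add: abs_square_less_1 field_simps)
  then have pos: "\<xi> * c > 0" by linarith
  \<comment> \<open>The difference of the two root equations factors; the second factor has the sign
    of \<xi> and cannot vanish.\<close>
  have "(c - f_hat \<xi>) * (c + f_hat \<xi> + 2 * \<xi>) = 0"
    using root f_hat_root[of \<xi>] by algebra
  moreover have "\<xi> * (c + f_hat \<xi> + 2 * \<xi>) > 0"
    using add_pos_nonneg[OF add_pos_pos[OF pos f_hat_sgn[OF assms]], of "2 * (\<xi> * \<xi>)"]
    by (simp add: algebra_simps)
  ultimately show "c = f_hat \<xi>" by auto
qed

text \<open>The bound on \<open>s\<close> has to be explicit: \<open>sqrt\<close> is total and odd,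
  so for a negative argument the formula for \<open>y\<close> would still define a real number, but
  not a solution.\<close>

lemma square_shift_eq_iff_sqrt:
  fixes y \<xi> s :: real
  shows "(y + \<xi>)\<^sup>2 = \<xi>\<^sup>2 - s \<longleftrightarrow>
    s \<le> \<xi>\<^sup>2 \<and> (\<exists>t\<in>{-1, 1}. y = - \<xi> - t * sqrt (\<xi>\<^sup>2 - s))"
proof
  assume eq: "(y + \<xi>)\<^sup>2 = \<xi>\<^sup>2 - s"
  then have "s \<le> \<xi>\<^sup>2"
    using zero_le_power2[of "y + \<xi>"] by linarith
  moreover have "sqrt (\<xi>\<^sup>2 - s) = \<bar>y + \<xi>\<bar>"
    by (simp flip: eq)
  ultimately show "s \<le> \<xi>\<^sup>2 \<and> (\<exists>t\<in>{-1, 1}. y = - \<xi> - t * sqrt (\<xi>\<^sup>2 - s))"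
    by (auto simp: abs_if)
qed (auto simp: power2_eq_square)

theorem lemma2:
  fixes N :: nat and a :: real and b q r k :: "nat \<Rightarrow> real"
  assumes "N \<ge> 1"
    and "\<And>i. i \<in> {1..N} \<Longrightarrow> b i \<noteq> 0"
    and "\<And>i. i \<in> {1..N} \<Longrightarrow> r i > 0"
    and "\<And>i j. i \<in> {1..N} \<Longrightarrow> j \<in> {1..N} \<Longrightarrow> i \<le> j \<Longrightarrow> sigma b q r j \<le> sigma b q r i"
    and "sigma b q r N > -1"
  shows "feedback_nash_equilibrium N a b q r (linear_feedback k) \<and> closed_loop N a b k \<noteq> 0 \<longleftrightarrow>
    (\<exists>(t :: nat \<Rightarrow> real) (\<xi> :: real).
       (\<forall>i\<in>{1..N}. t i \<in> {-1, 1}) \<and> \<xi> \<noteq> 0 \<and>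
       (\<forall>i\<in>{1..N}. sigma b q r i \<le> \<xi>\<^sup>2) \<and>
       (\<forall>i\<in>{1..N}. k i = (- \<xi> - t i * sqrt (\<xi>\<^sup>2 - sigma b q r i)) / b i) \<and>
       a = f_hat \<xi> + real N * \<xi> + (\<Sum>i\<in>{1..N}. t i * sqrt (\<xi>\<^sup>2 - sigma b q r i)))"
proof -
  define c where "c = closed_loop N a b k"
  \<comment> \<open>The ordering makes the value at \<open>N\<close> the smallest, so its bound
    passes to all players.\<close>
  have \<sigma>: "sigma b q r i > -1" if "i \<in> {1..N}" for i
    using assms(4)[of i N] assms(5) that by auto
  have quad: "c * y\<^sup>2 + (1 - c\<^sup>2) * y + c * s = 0 \<longleftrightarrow> (y + \<xi>)\<^sup>2 = \<xi>\<^sup>2 - s"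
    if "c \<noteq> 0" "\<xi> = (1 - c\<^sup>2) / (2 * c)" for y \<xi> s
  proof -
    have "c * y\<^sup>2 + (1 - c\<^sup>2) * y + c * s = c * ((y + \<xi>)\<^sup>2 - (\<xi>\<^sup>2 - s))"
    proof -
      have "1 - c\<^sup>2 = 2 * c * \<xi>"
        using that by simp
      then show ?thesis
        by algebra
    qed
    then show ?thesis
      using that(1) by auto
  qed
  have fne: "feedback_nash_equilibrium N a b q r (linear_feedback k) \<longleftrightarrow>
      (\<forall>i\<in>{1..N}. (b i * k i + \<xi>)\<^sup>2 = \<xi>\<^sup>2 - sigma b q r i)"
    if "c \<noteq> 0" "\<bar>c\<bar> < 1" "\<xi> = (1 - c\<^sup>2) / (2 * c)" for \<xi>
  proof -
    have "(\<forall>l. \<bar>c + b i * (l - k i)\<bar> < 1 \<longrightarrow>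
        (q i + r i * (k i)\<^sup>2) / (1 - c\<^sup>2) \<le> (q i + r i * l\<^sup>2) / (1 - (c + b i * (l - k i))\<^sup>2))
      \<longleftrightarrow> (b i * k i + \<xi>)\<^sup>2 = \<xi>\<^sup>2 - sigma b q r i" if i: "i \<in> {1..N}" for i
      using best_response_iff[OF assms(2,3)[OF i] \<open>\<bar>c\<bar> < 1\<close> \<open>c \<noteq> 0\<close>] \<sigma>[OF i]
        quad[OF \<open>c \<noteq> 0\<close> \<open>\<xi> = _\<close>]
      unfolding sigma_def by blast
    then show ?thesis
      using \<open>\<bar>c\<bar> < 1\<close> by (simp add: feedback_nash_equilibrium_linear_feedback_iff flip: c_def)
  qed
  have gain: "k i = z / b i \<longleftrightarrow> b i * k i = z" if "i \<in> {1..N}" for i z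
    using assms(2)[OF that] by (auto simp: field_simps)
  \<comment> \<open>Summing the gains turns \<open>c = a + (\<Sum>i\<in>{1..N}. b i * k i)\<close>
    into the formula for \<open>a\<close>, with \<open>c\<close> in place of
    \<open>f_hat \<xi>\<close>.\<close>
  have loop: "a = f_hat \<xi> + real N * \<xi> + (\<Sum>i\<in>{1..N}. t i * sqrt (\<xi>\<^sup>2 - sigma b q r i))
      \<longleftrightarrow> c = f_hat \<xi>"
    if "\<forall>i\<in>{1..N}. b i * k i = - \<xi> - t i * sqrt (\<xi>\<^sup>2 - sigma b q r i)" for t \<xi>
  proof -
    have "(\<Sum>i\<in>{1..N}. b i * k i)
        = (\<Sum>i\<in>{1..N}. - \<xi> - t i * sqrt (\<xi>\<^sup>2 - sigma b q r i))"
      using that by (intro sum.cong) auto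
    also have "\<dots> = - (real N * \<xi>) - (\<Sum>i\<in>{1..N}. t i * sqrt (\<xi>\<^sup>2 - sigma b q r i))"
      by (simp add: sum_subtractf)
    finally show ?thesis
      unfolding c_def closed_loop_def by auto
  qed
  have "feedback_nash_equilibrium N a b q r (linear_feedback k) \<and> c \<noteq> 0 \<longleftrightarrow>
      (\<exists>\<xi>. \<xi> \<noteq> 0 \<and> c = f_hat \<xi> \<and>
        (\<forall>i\<in>{1..N}. (b i * k i + \<xi>)\<^sup>2 = \<xi>\<^sup>2 - sigma b q r i))" (is "?L \<longleftrightarrow> ?R")
  proof
    assume L: ?L
    then have c: "\<bar>c\<bar> < 1"
      by (simp add: feedback_nash_equilibrium_def admissible_linear_feedback c_def)
    define \<xi> where "\<xi> = (1 - c\<^sup>2) / (2 * c)"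
    have "c\<^sup>2 < 1"
      using c by (simp add: abs_square_less_1)
    then have "\<xi> \<noteq> 0"
      using L by (auto simp: \<xi>_def)
    then show ?R
      using L c fne[of \<xi>] f_hat_eq_iff[of \<xi> c] \<xi>_def by blast
  next
    assume ?R
    then show ?L
      using fne f_hat_eq_iff by blast
  qed
  also have "\<dots> \<longleftrightarrow> (\<exists>(t :: nat \<Rightarrow> real) \<xi>. (\<forall>i\<in>{1..N}. t i \<in> {-1, 1}) \<and> \<xi> \<noteq> 0 \<and>
       (\<forall>i\<in>{1..N}. sigma b q r i \<le> \<xi>\<^sup>2) \<and>
       (\<forall>i\<in>{1..N}. b i * k i = - \<xi> - t i * sqrt (\<xi>\<^sup>2 - sigma b q r i)) \<and> c = f_hat \<xi>)"
    \<comment> \<open>Bounded choice collects the signs of the individual players into one function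
      \<open>t\<close>.\<close>
    unfolding square_shift_eq_iff_sqrt ball_conj_distrib bchoice_iff Bex_def by blast
  also have "\<dots> \<longleftrightarrow> (\<exists>(t :: nat \<Rightarrow> real) \<xi>. (\<forall>i\<in>{1..N}. t i \<in> {-1, 1}) \<and> \<xi> \<noteq> 0 \<and>
       (\<forall>i\<in>{1..N}. sigma b q r i \<le> \<xi>\<^sup>2) \<and>
       (\<forall>i\<in>{1..N}. k i = (- \<xi> - t i * sqrt (\<xi>\<^sup>2 - sigma b q r i)) / b i) \<and>
       a = f_hat \<xi> + real N * \<xi> + (\<Sum>i\<in>{1..N}. t i * sqrt (\<xi>\<^sup>2 - sigma b q r i)))"
    using loop gain by (simp cong: conj_cong)
  finally show ?thesis
    by (simp only: c_def)
qed

end
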